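(* Let $c\ge1$, let $G$ be a finite nilpotent group of class $t\ge2$, and let $G\cong F/R$ be a free presentation. Then (i) $|\gamma_{c+1}(G)|\,|M^{(c)}(G)|=|M^{(c)}(G/G')|\prod_{k=1}^{t-1}\left|[\gamma_{k+1}(F)R,{}_cF]/[\gamma_{k+2}(F)R,{}_cF]\right|$; (ii) $\exp(M^{(c)}(G))$ divides $\exp(M^{(c)}(G/G'))\prod_{k=1}^{t-1}\exp\left([\gamma_{k+1}(F)R,{}_cF]/[\gamma_{k+2}(F)R,{}_cF]\right)$; (iii) $d(M^{(c)}(G))\le d(M^{(c)}(G/G'))+\sum_{k=1}^{t-1}d\left([\gamma_{k+1}(F)R,{}_cF]/[\gamma_{k+2}(F)R,{}_cF]\right)$.
   Context: $\gamma_1(X)=X$, $\gamma_{i+1}(X)=[\gamma_i(X),X]$; $G'=\gamma_2(G)$. For subgroups $U,V$, $[U,{}_0V]=U$, $[U,{}_{i+1}V]=[[U,{}_iV],V]$. The $c$-nilpotent multiplier of $G\cong F/R$ ($F$ free) is $M^{(c)}(G)=(R\cap\gamma_{c+1}(F))/[R,{}_cF]$, independent of the presentation. $d(X)$ is the minimal number of generators and $\exp(X)$ the exponent. *)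

theory Defs
  imports "HOL-Algebra.Algebra"
begin

definition comm_sub :: "('a, 'm) monoid_scheme \<Rightarrow> 'a set \<Rightarrow> 'a set \<Rightarrow> 'a set" where
  "comm_sub G U V = generate G
     {inv\<^bsub>G\<^esub> u \<otimes>\<^bsub>G\<^esub> inv\<^bsub>G\<^esub> v \<otimes>\<^bsub>G\<^esub> u \<otimes>\<^bsub>G\<^esub> v | u v. u \<in> U \<and> v \<in> V}"

text \<open>Lower central series: gamma G 1 = carrier G, gamma G (i+1) = [gamma G i, G].
  (The value at index 0 is irrelevant and set to carrier G.)\<close>
fun gamma :: "('a, 'm) monoid_scheme \<Rightarrow> nat \<Rightarrow> 'a set" where
  "gamma G 0 = carrier G"
| "gamma G (Suc 0) = carrier G"
| "gamma G (Suc (Suc n)) = comm_sub G (gamma G (Suc n)) (carrier G)"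

fun iter_comm :: "('a, 'm) monoid_scheme \<Rightarrow> 'a set \<Rightarrow> nat \<Rightarrow> 'a set \<Rightarrow> 'a set" where
  "iter_comm G U 0 V = U"
| "iter_comm G U (Suc i) V = comm_sub G (iter_comm G U i V) V"

definition nilpotent_class :: "('a, 'm) monoid_scheme \<Rightarrow> nat \<Rightarrow> bool" where
  "nilpotent_class G t \<longleftrightarrow> gamma G (Suc t) = {\<one>\<^bsub>G\<^esub>} \<and> (\<forall>s<t. gamma G (Suc s) \<noteq> {\<one>\<^bsub>G\<^esub>})"

definition word_eval :: "('a, 'm) monoid_scheme \<Rightarrow> ('a \<times> bool) list \<Rightarrow> 'a" where
  "word_eval G w = foldr (\<lambda>(x, b) acc. (if b then x else inv\<^bsub>G\<^esub> x) \<otimes>\<^bsub>G\<^esub> acc) w \<one>\<^bsub>G\<^esub>"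

definition reduced_word :: "('a \<times> bool) list \<Rightarrow> bool" where
  "reduced_word w \<longleftrightarrow>
     (\<forall>i. Suc i < length w \<longrightarrow> \<not> (fst (w ! i) = fst (w ! Suc i) \<and> snd (w ! i) \<noteq> snd (w ! Suc i)))"

definition free_group_on :: "('a, 'm) monoid_scheme \<Rightarrow> 'a set \<Rightarrow> bool" where
  "free_group_on F B \<longleftrightarrow> group F \<and> B \<subseteq> carrier F \<and> generate F B = carrier F \<and>
     (\<forall>w. w \<noteq> [] \<and> fst ` set w \<subseteq> B \<and> reduced_word w \<longrightarrow> word_eval F w \<noteq> \<one>\<^bsub>F\<^esub>)"

definition free_group :: "('a, 'm) monoid_scheme \<Rightarrow> bool" where
  "free_group F \<longleftrightarrow> (\<exists>B. free_group_on F B)"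

definition quot :: "('a, 'm) monoid_scheme \<Rightarrow> 'a set \<Rightarrow> 'a set \<Rightarrow> 'a set monoid" where
  "quot G A B = (G\<lparr>carrier := A\<rparr>) Mod B"

definition grp_exponent :: "('a, 'm) monoid_scheme \<Rightarrow> nat" where
  "grp_exponent G = (if \<exists>n::nat>0. \<forall>x\<in>carrier G. x [^]\<^bsub>G\<^esub> n = \<one>\<^bsub>G\<^esub>
                  then LEAST n::nat. n > 0 \<and> (\<forall>x\<in>carrier G. x [^]\<^bsub>G\<^esub> n = \<one>\<^bsub>G\<^esub>) else 0)"

definition min_gens :: "('a, 'm) monoid_scheme \<Rightarrow> nat" where
  "min_gens G = (LEAST n. \<exists>S. S \<subseteq> carrier G \<and> finite S \<and> card S = n \<and> generate G S = carrier G)"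

definition c_multiplier :: "nat \<Rightarrow> ('a, 'm) monoid_scheme \<Rightarrow> 'a set \<Rightarrow> 'a set monoid" where
  "c_multiplier c F R = quot F (R \<inter> gamma F (Suc c)) (iter_comm F R c (carrier F))"

end

theory Submission
  imports Defs
begin

text \<open>
  Put \<open>A\<^sub>k = [\<gamma>\<^sub>k(F)R, \<^sub>cF]\<close>. Since \<open>[\<gamma>\<^sub>k(F)R, F] \<subseteq> \<gamma>\<^sub>k\<^sub>+\<^sub>1(F)R\<close>, the chain
  \<open>\<gamma>\<^sub>c\<^sub>+\<^sub>1(F) = A\<^sub>1 \<supseteq> A\<^sub>2 \<supseteq> \<dots> \<supseteq> A\<^sub>t\<^sub>+\<^sub>1 = [R, \<^sub>cF]\<close> has central factors \<open>A\<^sub>k/A\<^sub>k\<^sub>+\<^sub>1\<close>; the first one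
  is the multiplier of \<open>G/G'\<close>, and the multiplier of \<open>G\<close> is the subgroup
  \<open>(R \<inter> A\<^sub>1)/A\<^sub>t\<^sub>+\<^sub>1\<close> of \<open>A\<^sub>1/A\<^sub>t\<^sub>+\<^sub>1\<close>, of index \<open>|\<gamma>\<^sub>c\<^sub>+\<^sub>1(G)|\<close>. This gives (i) and (ii).
  For (iii) intersect the chain with \<open>R\<close> and use that subgroups of a finitely generated abelian
  group need no more generators than the group itself. As \<open>F\<close> may have infinite rank, finite
  generation of the factors has to be proved: modulo \<open>A\<^sub>k\<^sub>+\<^sub>1\<close> the commutator
  \<open>[a, x\<^sub>1, \<dots>, x\<^sub>c]\<close> is multiplicative in each entry and, because
  \<open>[\<gamma>\<^sub>i(F), R] \<subseteq> [R, \<^sub>iF]\<close> by the three subgroups lemma, it depends only on the entries modulo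
  the finite-index subgroup \<open>R\<close>.
\<close>

section \<open>Commutators and their identities\<close>

definition commutator :: "('a, 'm) monoid_scheme \<Rightarrow> 'a \<Rightarrow> 'a \<Rightarrow> 'a" where
  "commutator G x y = inv\<^bsub>G\<^esub> x \<otimes>\<^bsub>G\<^esub> inv\<^bsub>G\<^esub> y \<otimes>\<^bsub>G\<^esub> x \<otimes>\<^bsub>G\<^esub> y"

lemma comm_sub_commutator:
  "comm_sub G U V = generate G {commutator G u v | u v. u \<in> U \<and> v \<in> V}"
  by (simp add: comm_sub_def commutator_def)

lemma comm_sub_incl: "u \<in> U \<Longrightarrow> v \<in> V \<Longrightarrow> commutator G u v \<in> comm_sub G U V"
  unfolding comm_sub_commutator by (rule generate.incl) blast

context group
begin

lemma inv_mult_cancel [simp]: "x \<in> carrier G \<Longrightarrow> y \<in> carrier G \<Longrightarrow> inv x \<otimes> (x \<otimes> y) = y"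
  by (simp flip: m_assoc)

lemma mult_inv_cancel [simp]: "x \<in> carrier G \<Longrightarrow> y \<in> carrier G \<Longrightarrow> x \<otimes> (inv x \<otimes> y) = y"
  by (simp flip: m_assoc)

lemmas group_word_simps = m_assoc inv_mult_group commutator_def

lemma commutator_closed [simp, intro]:
  "x \<in> carrier G \<Longrightarrow> y \<in> carrier G \<Longrightarrow> commutator G x y \<in> carrier G"
  by (simp add: commutator_def)

lemma commutator_inv: "x \<in> carrier G \<Longrightarrow> y \<in> carrier G \<Longrightarrow>
    inv (commutator G x y) = commutator G y x"
  by (simp add: group_word_simps)

lemma commutator_mult_left:
  assumes "x \<in> carrier G" "y \<in> carrier G" "z \<in> carrier G"
  shows "commutator G (x \<otimes> y) z = inv y \<otimes> commutator G x z \<otimes> y \<otimes> commutator G y z"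
  using assms by (simp add: group_word_simps)

lemma commutator_mult_right:
  assumes "x \<in> carrier G" "y \<in> carrier G" "z \<in> carrier G"
  shows "commutator G x (y \<otimes> z) = commutator G x z \<otimes> (inv z \<otimes> commutator G x y \<otimes> z)"
  using assms by (simp add: group_word_simps)

lemma commutator_inv_left:
  assumes "x \<in> carrier G" "z \<in> carrier G"
  shows "commutator G (inv x) z = x \<otimes> inv (commutator G x z) \<otimes> inv x"
  using assms by (simp add: group_word_simps)

lemma commutator_inv_right:
  assumes "x \<in> carrier G" "z \<in> carrier G"
  shows "commutator G x (inv z) = z \<otimes> inv (commutator G x z) \<otimes> inv z"
  using assms by (simp add: group_word_simps)

lemma conj_eq_mult_commutator:
  assumes "x \<in> carrier G" "z \<in> carrier G"
  shows "inv z \<otimes> x \<otimes> z = x \<otimes> commutator G x z"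
  using assms by (simp add: group_word_simps)

text \<open>The Hall-Witt identity with \<open>y\<close> replaced by its inverse, solved for the
  factor containing [x, y, z]; both sides reduce to the same word.\<close>

lemma hall_witt:
  assumes "x \<in> carrier G" "y \<in> carrier G" "z \<in> carrier G"
  shows "commutator G (commutator G x y) z =
     inv y \<otimes> inv (inv z \<otimes> commutator G (commutator G (inv y) (inv z)) x \<otimes> z \<otimes>
       (inv x \<otimes> commutator G (commutator G z (inv x)) (inv y) \<otimes> x)) \<otimes> y"
  using assms by (simp add: group_word_simps)

lemma normal_conj_inv_left:
  assumes "N \<lhd> G" "x \<in> carrier G" "h \<in> N" shows "inv x \<otimes> h \<otimes> x \<in> N"
  by (rule normal.inv_op_closed1[OF assms])

lemma normal_conj_inv_right:
  assumes "N \<lhd> G" "x \<in> carrier G" "h \<in> N" shows "x \<otimes> h \<otimes> inv x \<in> N"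
  by (rule normal.inv_op_closed2[OF assms])

lemmas normal_subgroup_closed =
  subgroup.m_closed[OF normal_imp_subgroup] subgroup.m_inv_closed[OF normal_imp_subgroup]
  subgroup.one_closed[OF normal_imp_subgroup] normal_conj_inv_left normal_conj_inv_right

lemma normal_carrier: "N \<lhd> G \<Longrightarrow> x \<in> N \<Longrightarrow> x \<in> carrier G"
  by (rule subgroup.mem_carrier[OF normal_imp_subgroup])

section \<open>Commutator subgroups and the three subgroups lemma\<close>

lemma comm_sub_subset_iff:
  assumes "subgroup N G"
  shows "comm_sub G U V \<subseteq> N \<longleftrightarrow> (\<forall>u\<in>U. \<forall>v\<in>V. commutator G u v \<in> N)"
proof
  assume "comm_sub G U V \<subseteq> N"
  thus "\<forall>u\<in>U. \<forall>v\<in>V. commutator G u v \<in> N"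
    by (intro ballI subsetD[OF _ comm_sub_incl])
next
  assume "\<forall>u\<in>U. \<forall>v\<in>V. commutator G u v \<in> N"
  thus "comm_sub G U V \<subseteq> N"
    unfolding comm_sub_commutator by (intro generate_subgroup_incl[OF _ assms]) auto
qed

lemma comm_sub_mono: "U \<subseteq> U' \<Longrightarrow> V \<subseteq> V' \<Longrightarrow> comm_sub G U V \<subseteq> comm_sub G U' V'"
  unfolding comm_sub_commutator by (rule mono_generate) fast

text \<open>Conjugating a commutator conjugates both entries, so the generating set is closed under
  conjugation.\<close>

lemma comm_sub_normal:
  assumes "U \<lhd> G" "V \<lhd> G" shows "comm_sub G U V \<lhd> G"
  unfolding comm_sub_commutator
proof (rule normal_generateI)
  show "{commutator G u v |u v. u \<in> U \<and> v \<in> V} \<subseteq> carrier G"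
    using assms normal_carrier by blast
  fix h g assume "h \<in> {commutator G u v |u v. u \<in> U \<and> v \<in> V}" and g: "g \<in> carrier G"
  then obtain u v where h: "h = commutator G u v" and uv: "u \<in> U" "v \<in> V" by blast
  note c = normal_carrier[OF assms(1) uv(1)] normal_carrier[OF assms(2) uv(2)]
  have "g \<otimes> h \<otimes> inv g = commutator G (g \<otimes> u \<otimes> inv g) (g \<otimes> v \<otimes> inv g)"
    using c g by (simp add: h group_word_simps)
  thus "g \<otimes> h \<otimes> inv g \<in> {commutator G u v |u v. u \<in> U \<and> v \<in> V}"
    using normal_conj_inv_right assms g uv by blast
qed

lemma comm_sub_subset_left:
  assumes "U \<lhd> G" "V \<subseteq> carrier G" shows "comm_sub G U V \<subseteq> U"
proof -
  have "commutator G u v \<in> U" if "u \<in> U" "v \<in> V" for u v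
  proof -
    have "commutator G u v = inv u \<otimes> (inv v \<otimes> u \<otimes> v)"
      using that assms normal_carrier by (simp add: group_word_simps subsetD)
    thus ?thesis using that assms by (simp add: normal_subgroup_closed subsetD)
  qed
  thus ?thesis using comm_sub_subset_iff normal_imp_subgroup assms by blast
qed

lemma comm_sub_commute_le:
  assumes "U \<lhd> G" "V \<lhd> G" shows "comm_sub G U V \<subseteq> comm_sub G V U"
proof -
  have sg: "subgroup (comm_sub G V U) G"
    using comm_sub_normal assms normal_imp_subgroup by blast
  have "commutator G u v \<in> comm_sub G V U" if "u \<in> U" "v \<in> V" for u v
    using commutator_inv[of v u] subgroup.m_inv_closed[OF sg] comm_sub_incl[of v V u U] that
      normal_carrier assms by metis
  thus ?thesis using comm_sub_subset_iff[OF sg] by blast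
qed

lemma comm_sub_commute: "U \<lhd> G \<Longrightarrow> V \<lhd> G \<Longrightarrow> comm_sub G U V = comm_sub G V U"
  using comm_sub_commute_le by blast

text \<open>These are the elements centralising \<open>V\<close> modulo \<open>N\<close>: the
  conjugations in the product and inverse rules for commutators stay inside the normal subgroup
  \<open>N\<close>. It allows the first entry to be tested on generators only.\<close>

lemma subgroup_commutator_left:
  assumes N: "N \<lhd> G" and V: "V \<subseteq> carrier G"
  shows "subgroup {x \<in> carrier G. \<forall>v\<in>V. commutator G x v \<in> N} G"
proof (rule subgroupI)
  show "{x \<in> carrier G. \<forall>v\<in>V. commutator G x v \<in> N} \<noteq> {}"
    using V N by (auto intro!: exI[of _ "\<one>"] simp: commutator_def normal_subgroup_closed subsetD)
next
  fix x assume "x \<in> {x \<in> carrier G. \<forall>v\<in>V. commutator G x v \<in> N}"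
  thus "inv x \<in> {x \<in> carrier G. \<forall>v\<in>V. commutator G x v \<in> N}"
    using V by (simp add: commutator_inv_left subsetD normal_subgroup_closed[OF N])
next
  fix x y assume "x \<in> {x \<in> carrier G. \<forall>v\<in>V. commutator G x v \<in> N}"
    "y \<in> {x \<in> carrier G. \<forall>v\<in>V. commutator G x v \<in> N}"
  thus "x \<otimes> y \<in> {x \<in> carrier G. \<forall>v\<in>V. commutator G x v \<in> N}"
    using V by (simp add: commutator_mult_left subsetD normal_subgroup_closed[OF N])
qed auto

text \<open>By \<open>hall_witt\<close>, [u, v, w] is built from conjugates and inverses of elements
  of the two subgroups assumed to lie in \<open>N\<close>. The step from the generators [u, v] to
  all of [U, V] is \<open>subgroup_commutator_left\<close>.\<close>

lemma three_subgroups: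
  assumes U: "U \<lhd> G" and V: "V \<lhd> G" and W: "W \<lhd> G" and N: "N \<lhd> G"
    and 1: "comm_sub G (comm_sub G V W) U \<subseteq> N" and 2: "comm_sub G (comm_sub G W U) V \<subseteq> N"
  shows "comm_sub G (comm_sub G U V) W \<subseteq> N"
proof -
  let ?C = "{x \<in> carrier G. \<forall>w\<in>W. commutator G x w \<in> N}"
  have "commutator G (commutator G u v) w \<in> N" if "u \<in> U" "v \<in> V" "w \<in> W" for u v w
  proof -
    have c: "u \<in> carrier G" "v \<in> carrier G" "w \<in> carrier G"
      using that normal_carrier U V W by blast+
    have "commutator G (commutator G (inv v) (inv w)) u \<in> N"
      using 1 that by (blast intro: comm_sub_incl normal_subgroup_closed(2)[OF V]
          normal_subgroup_closed(2)[OF W])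
    moreover have "commutator G (commutator G w (inv u)) (inv v) \<in> N"
      using 2 that by (blast intro: comm_sub_incl normal_subgroup_closed(2)[OF V]
          normal_subgroup_closed(2)[OF U])
    ultimately show ?thesis
      unfolding hall_witt[OF c] using c by (intro normal_subgroup_closed[OF N])
  qed
  hence "\<forall>u\<in>U. \<forall>v\<in>V. commutator G u v \<in> ?C"
    using normal_carrier U V by blast
  moreover have "subgroup ?C G"
    using subgroup_commutator_left[OF N] W normal_carrier by blast
  ultimately have "comm_sub G U V \<subseteq> ?C" using comm_sub_subset_iff by blast
  thus ?thesis using comm_sub_subset_iff[OF normal_imp_subgroup[OF N]] by blast
qed

section \<open>Lower central series and iterated commutators\<close>

lemma gamma_Suc: "i \<ge> 1 \<Longrightarrow> gamma G (Suc i) = comm_sub G (gamma G i) (carrier G)"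
  by (cases i) auto

lemma gamma_normal: "gamma G i \<lhd> G"
proof (induction i)
  case (Suc i)
  thus ?case by (cases i) (simp_all add: normal_self comm_sub_normal)
qed (simp add: normal_self)

lemma gamma_Suc_subset: "gamma G (Suc i) \<subseteq> gamma G i"
  by (cases i) (simp_all add: gamma_normal comm_sub_subset_left)

lemma gamma_antimono: "i \<le> j \<Longrightarrow> gamma G j \<subseteq> gamma G i"
  by (rule lift_Suc_antimono_le[of "gamma G"]) (rule gamma_Suc_subset)

text \<open>Moves the innermost bracket into the starting subgroup, so that an induction may replace
  \<open>U\<close> by [U, V].\<close>

lemma iter_comm_Suc_left: "iter_comm G U (Suc i) V = iter_comm G (comm_sub G U V) i V"
  by (induction i) auto

lemma iter_comm_mono: "U \<subseteq> U' \<Longrightarrow> iter_comm G U i V \<subseteq> iter_comm G U' i V"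
  by (induction i) (simp_all add: comm_sub_mono)

lemma iter_comm_normal: "U \<lhd> G \<Longrightarrow> iter_comm G U i (carrier G) \<lhd> G"
  by (induction i) (simp_all add: normal_self comm_sub_normal)

lemma iter_comm_antimono:
  assumes "U \<lhd> G" "i \<le> j"
  shows "iter_comm G U j (carrier G) \<subseteq> iter_comm G U i (carrier G)"
  using assms(2)
  by (rule lift_Suc_antimono_le[of "\<lambda>i. iter_comm G U i (carrier G)", rotated])
     (simp add: comm_sub_subset_left iter_comm_normal assms(1))

lemma iter_comm_carrier: "iter_comm G (carrier G) i (carrier G) = gamma G (Suc i)"
  by (induction i) auto

text \<open>Induction on \<open>i\<close> for all normal \<open>R\<close> at once. The three
  subgroups lemma for gamma_{i+1}(G), G and R asks for [[G, R], gamma_{i+1}(G)], where the induction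
  hypothesis is used for [R, G], and for [[R, gamma_{i+1}(G)], G], where it is used for
  \<open>R\<close>.\<close>

lemma comm_sub_gamma_subset:
  assumes "R \<lhd> G"
  shows "comm_sub G (gamma G (Suc i)) R \<subseteq> iter_comm G R (Suc i) (carrier G)"
  using assms
proof (induction i arbitrary: R)
  case 0
  thus ?case by (simp add: comm_sub_commute normal_self)
next
  case (Suc i)
  note n = normal_self comm_sub_normal gamma_normal iter_comm_normal Suc.prems
  have "comm_sub G (comm_sub G (gamma G (Suc i)) (carrier G)) R
      \<subseteq> iter_comm G R (Suc (Suc i)) (carrier G)"
  proof (rule three_subgroups)
    have "comm_sub G (comm_sub G (carrier G) R) (gamma G (Suc i))
        = comm_sub G (gamma G (Suc i)) (comm_sub G R (carrier G))"
      by (simp only: comm_sub_commute[OF normal_self Suc.prems] comm_sub_commute[OF gamma_normal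
          comm_sub_normal[OF Suc.prems normal_self]])
    thus "comm_sub G (comm_sub G (carrier G) R) (gamma G (Suc i))
        \<subseteq> iter_comm G R (Suc (Suc i)) (carrier G)"
      using Suc.IH[of "comm_sub G R (carrier G)"] 
      by (simp add: n iter_comm_Suc_left del: iter_comm.simps)
    show "comm_sub G (comm_sub G R (gamma G (Suc i))) (carrier G)
        \<subseteq> iter_comm G R (Suc (Suc i)) (carrier G)"
      using comm_sub_mono[OF Suc.IH[OF Suc.prems] order_refl]
      by (simp add: comm_sub_commute[OF Suc.prems gamma_normal])
  qed (intro n)+
  thus ?case by simp
qed

text \<open>Modulo \<open>V\<close>, assumption \<open>3\<close> makes [U, G] central, so
  commutators are multiplicative in both entries; entries from \<open>U'\<close> and
  \<open>Z\<close> contribute nothing by \<open>1\<close> and \<open>2\<close>. This transfers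
  generators of U modulo U' to generators of [U, G] modulo V.\<close>

lemma comm_sub_generated:
  assumes U: "U \<lhd> G" and V: "V \<lhd> G" and S: "S \<subseteq> U" "U \<subseteq> generate G (S \<union> U')" and U': "U' \<subseteq> U"
    and T: "T \<subseteq> carrier G" "carrier G \<subseteq> generate G (T \<union> Z)" and Z: "Z \<subseteq> carrier G"
    and 1: "comm_sub G U' (carrier G) \<subseteq> V" and 2: "comm_sub G U Z \<subseteq> V"
    and 3: "comm_sub G (comm_sub G U (carrier G)) (carrier G) \<subseteq> V"
  shows "comm_sub G U (carrier G) \<subseteq>
           generate G ((\<lambda>(s, t). commutator G s t) ` (S \<times> T) \<union> V)"
proof -
  let ?X = "(\<lambda>(s, t). commutator G s t) ` (S \<times> T) \<union> V"
  define W where "W = generate G ?X"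
  have SG: "\<And>s. s \<in> S \<Longrightarrow> s \<in> carrier G" using S(1) normal_carrier[OF U] by auto
  have "?X \<subseteq> carrier G"
    using SG T(1) normal_carrier[OF V] by auto
  hence W: "subgroup W G" unfolding W_def by (rule generate_is_subgroup)
  have VW: "V \<subseteq> W" unfolding W_def by (auto intro: generate.incl)
  have ST: "commutator G s t \<in> W" if "s \<in> S" "t \<in> T" for s t
    unfolding W_def using that by (intro generate.incl) auto
  \<comment> \<open>\<open>W\<close> is not known to be normal, but conjugation changes an element
    of [U, G] only by a factor from [[U, G], G], hence from \<open>V\<close>.\<close>
  have conj: "inv x \<otimes> w \<otimes> x \<in> W" if "w \<in> comm_sub G U (carrier G)" "w \<in> W" "x \<in> carrier G" for w x
  proof -
    have "commutator G w x \<in> W"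
      using 3 VW comm_sub_incl[OF that(1,3)] by blast
    thus ?thesis
      using that W conj_eq_mult_commutator subgroup.mem_carrier subgroup.m_closed by metis
  qed
  have inv_conj: "x \<otimes> inv w \<otimes> inv x \<in> W"
    if "w \<in> comm_sub G U (carrier G)" "w \<in> W" "x \<in> carrier G" for w x
  proof -
    have "subgroup (comm_sub G U (carrier G)) G"
      using comm_sub_normal[OF U normal_self] by (rule normal_imp_subgroup)
    hence "inv w \<in> comm_sub G U (carrier G)" using that(1) by (rule subgroup.m_inv_closed)
    moreover have "inv w \<in> W" using W that(2) by (rule subgroup.m_inv_closed)
    ultimately show ?thesis using conj[of "inv w" "inv x"] that(3) by simp
  qed
  \<comment> \<open>With \<open>u\<close> fixed, the admissible second entries form a subgroup
    containing \<open>T\<close> and \<open>Z\<close>, hence all of \<open>G\<close>.\<close>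
  have *: "commutator G u f \<in> W" if u: "u \<in> U" "\<And>t. t \<in> T \<Longrightarrow> commutator G u t \<in> W"
    and f: "f \<in> carrier G" for u f
  proof -
    have uG: "u \<in> carrier G" using u(1) U normal_carrier by blast
    let ?C = "{f \<in> carrier G. commutator G u f \<in> W}"
    have inc: "commutator G u f \<in> comm_sub G U (carrier G)" if "f \<in> carrier G" for f
      using comm_sub_incl u(1) that by metis
    have "subgroup ?C G"
    proof (rule subgroupI)
      show "?C \<noteq> {}"
        using uG subgroup.one_closed[OF W] by (auto intro!: exI[of _ "\<one>"] simp: commutator_def)
    next
      fix a assume "a \<in> ?C"
      thus "inv a \<in> ?C" using inv_conj inc by (simp add: commutator_inv_right uG)
    next
      fix a b assume "a \<in> ?C" "b \<in> ?C"
      thus "a \<otimes> b \<in> ?C"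
        using conj inc by (simp add: commutator_mult_right uG subgroup.m_closed[OF W])
    qed auto
    moreover have "T \<union> Z \<subseteq> ?C"
      using u T(1) Z 2 VW comm_sub_incl[of u U _ Z G] by blast
    ultimately have "generate G (T \<union> Z) \<subseteq> ?C" by (intro generate_subgroup_incl)
    thus ?thesis using T f by blast
  qed
  \<comment> \<open>The same argument in the first entry: this subgroup contains \<open>S\<close> by
    \<open>*\<close> and \<open>U'\<close> by assumption \<open>1\<close>.\<close>
  let ?D = "{u \<in> U. \<forall>f \<in> carrier G. commutator G u f \<in> W}"
  have inc: "commutator G u f \<in> comm_sub G U (carrier G)" if "u \<in> U" "f \<in> carrier G" for u f
    using that by (rule comm_sub_incl)
  note Ucl = normal_subgroup_closed[OF U]
  have "subgroup ?D G"
  proof (rule subgroupI)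
    show "?D \<subseteq> carrier G" using normal_carrier[OF U] by blast
    show "?D \<noteq> {}"
      using Ucl(3) subgroup.one_closed[OF W] by (auto intro!: exI[of _ "\<one>"] simp: commutator_def)
  next
    fix a assume "a \<in> ?D"
    thus "inv a \<in> ?D"
      using inv_conj inc by (simp add: commutator_inv_left normal_carrier[OF U] Ucl(2))
  next
    fix a b assume "a \<in> ?D" "b \<in> ?D"
    thus "a \<otimes> b \<in> ?D"
      using conj inc
      by (simp add: commutator_mult_left normal_carrier[OF U] Ucl(1) subgroup.m_closed[OF W])
  qed
  moreover have "S \<union> U' \<subseteq> ?D"
  proof -
    have "S \<subseteq> ?D" using * S(1) ST by blast
    moreover have "commutator G u f \<in> W" if "u \<in> U'" "f \<in> carrier G" for u f
      using comm_sub_incl[OF that, of G] 1 VW by blast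
    ultimately show ?thesis using U' by blast
  qed
  ultimately have "U \<subseteq> ?D" using generate_subgroup_incl S(2) by blast
  hence "\<forall>u\<in>U. \<forall>v\<in>carrier G. commutator G u v \<in> W" by blast
  thus ?thesis using comm_sub_subset_iff[OF W] unfolding W_def by blast
qed

section \<open>Numbers of generators of subgroups\<close>

text \<open>Division with remainder by the least positive exponent that takes \<open>s\<close> into
  \<open>K\<close>; if there is none, \<open>K\<close> is trivial.\<close>

lemma subgroup_of_cyclic:
  assumes K: "subgroup K G" and s: "s \<in> carrier G" and le: "K \<subseteq> generate G {s}"
  shows "\<exists>k\<in>K. \<forall>x\<in>K. \<exists>q::int. x = k [^] q"
proof (cases "\<exists>n::nat. n > 0 \<and> s [^] int n \<in> K")
  case False
  have "x = \<one>" if x: "x \<in> K" for x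
  proof -
    obtain k :: int where k: "x = s [^] k" using le x generate_pow[OF s] by blast
    have "s [^] (- k) \<in> K"
      using subgroup.m_inv_closed[OF K x] unfolding k int_pow_neg[OF s] .
    moreover have "\<not> (l > 0 \<and> s [^] l \<in> K)" for l :: int
    proof
      assume l: "l > 0 \<and> s [^] l \<in> K"
      then obtain n where "n > 0" "l = int n" using zero_less_imp_eq_int by blast
      thus False using False l by blast
    qed
    ultimately have "\<not> k > 0 \<and> \<not> - k > 0" using x k by blast
    hence "k = 0" by linarith
    thus ?thesis using k by simp
  qed
  hence "\<forall>x\<in>K. x = \<one> [^] (0::int)" by (metis int_pow_0)
  thus ?thesis using subgroup.one_closed[OF K] by blast
next
  case True
  define d where "d = (LEAST n::nat. n > 0 \<and> s [^] int n \<in> K)"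
  have "d > 0 \<and> s [^] int d \<in> K"
    unfolding d_def by (rule LeastI_ex[OF True])
  hence d: "d > 0" "s [^] int d \<in> K" by blast+
  have "\<exists>q::int. x = (s [^] int d) [^] q" if x: "x \<in> K" for x
  proof -
    obtain k :: int where k: "x = s [^] k" using le x generate_pow[OF s] by blast
    define m where "m = nat (k mod int d)"
    have m: "int m = k mod int d" using d by (simp add: m_def)
    have "int m = k - int d * (k div int d)" unfolding m by (simp add: minus_mult_div_eq_mod)
    hence "s [^] int m = x \<otimes> inv ((s [^] int d) [^] (k div int d))"
      unfolding k int_pow_pow[OF s] by (simp only: int_pow_diff[OF s])
    moreover have "(s [^] int d) [^] (k div int d) \<in> K"
      by (rule subgroup_int_pow_closed[OF K d(2)])
    ultimately have mem: "s [^] int m \<in> K"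
      using subgroup.m_closed[OF K x subgroup.m_inv_closed[OF K]] by simp
    have "int m < int d" unfolding m using d(1) by simp
    hence "m < d" by simp
    hence "\<not> (m > 0 \<and> s [^] int m \<in> K)" unfolding d_def by (rule not_less_Least)
    hence "int m = 0" using mem by simp
    hence "k = int d * (k div int d)" using m mult_div_mod_eq[of "int d" k] by linarith
    hence "x = (s [^] int d) [^] (k div int d)"
      unfolding k int_pow_pow[OF s] by (rule arg_cong)
    thus ?thesis by blast
  qed
  thus ?thesis using d(2) by blast
qed

lemma r_coset_eq_iff:
  assumes "subgroup H G" "x \<in> carrier G" "y \<in> carrier G"
  shows "H #> x = H #> y \<longleftrightarrow> x \<otimes> inv y \<in> H"
  using assms by (metis repr_independence repr_independenceD subgroup.rcos_module is_group)

text \<open>Conjugation multiplies \<open>a\<close> by a commutator, which lies in \<open>B\<close>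
  and so in \<open>A\<close>.\<close>

lemma normal_between_central:
  assumes B: "B \<lhd> G" and A: "subgroup A G" "B \<subseteq> A"
    and central: "\<And>a x. a \<in> A \<Longrightarrow> x \<in> carrier G \<Longrightarrow> commutator G a x \<in> B"
  shows "A \<lhd> G"
proof (rule normal_invI[OF A(1)])
  fix x a assume x: "x \<in> carrier G" and a: "a \<in> A"
  have "x \<otimes> a \<otimes> inv x = a \<otimes> commutator G a (inv x)"
    using conj_eq_mult_commutator[of a "inv x"] x a subgroup.mem_carrier[OF A(1)] by simp
  thus "x \<otimes> a \<otimes> inv x \<in> A"
    using central[of a "inv x"] x a A by (auto intro: subgroup.m_closed)
qed

text \<open>Relative form of the fact that subgroups of an abelian group with n generators need at
  most n generators. Induction on \<open>S\<close>: without the last generator \<open>s\<close> one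
  gets a normal subgroup \<open>?A\<close> modulo which \<open>C\<close> is cyclic, and the
  induction hypothesis applies to the intersection of \<open>C\<close> and \<open>?A\<close>.
  Adjoining only \<open>B \<inter> C\<close> keeps everything inside \<open>C\<close>, so that the
  lemma can be iterated along a chain.\<close>

lemma subgroup_generators_mod_central:
  assumes B: "B \<lhd> G" and "finite S" and S: "S \<subseteq> carrier G"
    and central: "\<And>s x. s \<in> S \<Longrightarrow> x \<in> carrier G \<Longrightarrow> commutator G s x \<in> B"
    and C: "subgroup C G" "C \<subseteq> generate G (S \<union> B)"
  shows "\<exists>S'\<subseteq>C. finite S' \<and> card S' \<le> card S \<and> C \<subseteq> generate G (S' \<union> (B \<inter> C))"
  using assms(2-)
proof (induction S arbitrary: C rule: finite_induct)
  case empty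
  have "C \<subseteq> B"
    using empty generate_subgroup_incl[OF order_refl normal_imp_subgroup[OF B]] by auto
  hence "C \<subseteq> generate G ({} \<union> (B \<inter> C))" by (auto intro: generate.incl)
  thus ?case by (intro exI[of _ "{}"]) simp
next
  case (insert s S)
  let ?A = "generate G (S \<union> B)"
  have SB: "S \<union> B \<subseteq> carrier G" "insert s S \<union> B \<subseteq> carrier G"
    using insert.prems normal_carrier[OF B] by auto
  have A: "subgroup ?A G" by (rule generate_is_subgroup[OF SB(1)])
  have "?A \<lhd> G"
  proof (rule normal_between_central[OF B A])
    show "B \<subseteq> ?A" by (auto intro: generate.incl)
    \<comment> \<open>Centrality modulo \<open>B\<close> passes from the generators to all of
      \<open>?A\<close>.\<close>
    have "S \<union> B \<subseteq> {x \<in> carrier G. \<forall>v\<in>carrier G. commutator G x v \<in> B}"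
      using SB(1) insert.prems(2) subsetD[OF comm_sub_subset_left[OF B order_refl] comm_sub_incl]
      by auto
    hence "?A \<subseteq> {x \<in> carrier G. \<forall>v\<in>carrier G. commutator G x v \<in> B}"
      by (intro generate_subgroup_incl subgroup_commutator_left B order_refl)
    thus "\<And>a x. a \<in> ?A \<Longrightarrow> x \<in> carrier G \<Longrightarrow> commutator G a x \<in> B" by blast
  qed
  then interpret A: normal ?A G .
  interpret h: group_hom G "G Mod ?A" "\<lambda>x. ?A #> x"
    using A.factorgroup_is_group A.r_coset_hom_Mod
    by (simp add: group_hom_def group_hom_axioms_def is_group)
  \<comment> \<open>All generators except \<open>s\<close> become trivial modulo
    \<open>?A\<close>.\<close>
  have "(\<lambda>x. ?A #> x) ` (insert s S \<union> B) \<subseteq> generate (G Mod ?A) {?A #> s}"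
  proof -
    have "?A #> x = ?A" if "x \<in> S \<union> B" for x
      using that by (intro A.rcos_const is_group generate.incl)
    thus ?thesis
      using generate.one[of "G Mod ?A" "{?A #> s}"] generate.incl[of "?A #> s" "{?A #> s}" "G Mod ?A"]
      by auto
  qed
  hence "generate (G Mod ?A) ((\<lambda>x. ?A #> x) ` (insert s S \<union> B)) \<subseteq> generate (G Mod ?A) {?A #> s}"
    using insert.prems(1) by (intro h.H.generate_subgroup_incl h.H.generate_is_subgroup) auto
  hence "(\<lambda>x. ?A #> x) ` C \<subseteq> generate (G Mod ?A) {?A #> s}"
    using insert.prems(4) h.generate_img[OF SB(2)] by blast
  from h.H.subgroup_of_cyclic[OF h.subgroup_img_is_subgroup[OF insert.prems(3)] h.hom_closed this]
  obtain c where c: "c \<in> C"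
    and q: "\<forall>x\<in>C. \<exists>q::int. ?A #> x = (?A #> c) [^]\<^bsub>G Mod ?A\<^esub> q"
    using insert.prems(1) by (auto simp only: insert_subset ball_simps bex_simps)
  have CG: "\<And>x. x \<in> C \<Longrightarrow> x \<in> carrier G" by (rule subgroup.mem_carrier[OF insert.prems(3)])
  have CA: "subgroup (C \<inter> ?A) G" by (rule subgroups_Inter_pair[OF insert.prems(3) A])
  have "\<exists>S'\<subseteq>C \<inter> ?A. finite S' \<and> card S' \<le> card S \<and>
      C \<inter> ?A \<subseteq> generate G (S' \<union> (B \<inter> (C \<inter> ?A)))"
  proof (rule insert.IH[OF _ _ CA])
    show "S \<subseteq> carrier G" using insert.prems(1) by simp
    show "commutator G s x \<in> B" if "s \<in> S" "x \<in> carrier G" for s x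
      using that by (intro insert.prems(2)) auto
  qed simp
  then obtain S' where S': "S' \<subseteq> C \<inter> ?A" "finite S'" "card S' \<le> card S"
    "C \<inter> ?A \<subseteq> generate G (S' \<union> (B \<inter> (C \<inter> ?A)))" by blast
  let ?S = "insert c S'"
  have "C \<inter> ?A \<subseteq> generate G (?S \<union> (B \<inter> C))"
    by (rule order_trans[OF S'(4) mono_generate]) blast
  \<comment> \<open>Dividing \<open>x\<close> by a suitable power of \<open>c\<close> moves it into
    \<open>C \<inter> ?A\<close>.\<close>
  moreover have "x \<in> generate G (?S \<union> (B \<inter> C))" if x: "x \<in> C"
    and le: "C \<inter> ?A \<subseteq> generate G (?S \<union> (B \<inter> C))" for x
  proof -
    obtain k :: int where k: "?A #> x = (?A #> c) [^]\<^bsub>G Mod ?A\<^esub> k"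
      using bspec[OF q x] by blast
    hence "?A #> x = ?A #> (c [^] k)" using c CG by (simp add: h.hom_int_pow)
    hence "x \<otimes> inv (c [^] k) \<in> ?A" using r_coset_eq_iff[OF A] x c CG by simp
    moreover have ck: "c [^] k \<in> C" by (rule subgroup_int_pow_closed[OF insert.prems(3) c])
    hence "x \<otimes> inv (c [^] k) \<in> C"
      using x insert.prems(3) by (simp add: subgroup.m_closed subgroup.m_inv_closed)
    ultimately have "x \<otimes> inv (c [^] k) \<in> generate G (?S \<union> (B \<inter> C))" using le by blast
    moreover have "c [^] k \<in> generate G (?S \<union> (B \<inter> C))"
      using S'(1) CG c by (intro subgroup_int_pow_closed generate_is_subgroup generate.incl) auto
    ultimately have "x \<otimes> inv (c [^] k) \<otimes> c [^] k \<in> generate G (?S \<union> (B \<inter> C))"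
      by (rule generate.eng)
    thus ?thesis using x c CG by (simp add: m_assoc)
  qed
  ultimately have "C \<subseteq> generate G (?S \<union> (B \<inter> C))" by blast
  moreover have "card ?S \<le> card (insert s S)"
    using S'(2,3) insert.hyps by (simp add: card_insert_if)
  ultimately show ?case using S' c by (intro exI[of _ ?S]) auto
qed

end

section \<open>Cosets and homomorphic images\<close>

text \<open>Maps with the same fibres have images in bijection. Infinite images are covered, with
  \<open>card\<close> equal to 0 on both sides.\<close>

lemma card_image_cong_ker:
  assumes "\<And>x y. x \<in> A \<Longrightarrow> y \<in> A \<Longrightarrow> f x = f y \<longleftrightarrow> g x = g y"
  shows "card (f ` A) = card (g ` A)"
proof -
  define h where "h z = g (inv_into A f z)" for z
  have h: "h (f x) = g x" if "x \<in> A" for x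
  proof -
    have "inv_into A f (f x) \<in> A" "f (inv_into A f (f x)) = f x"
      using that by (auto intro: inv_into_into f_inv_into_f)
    thus ?thesis using assms[of "inv_into A f (f x)" x] that by (simp add: h_def)
  qed
  have "inj_on h (f ` A)"
  proof (rule inj_onI, elim imageE)
    fix z z' x y assume "h z = h z'" "z = f x" "x \<in> A" "z' = f y" "y \<in> A"
    thus "z = z'" using h assms[of x y] by simp
  qed
  hence "card (h ` f ` A) = card (f ` A)" by (rule card_image)
  moreover have "h ` f ` A = g ` A" using h by (simp add: image_image)
  ultimately show ?thesis by simp
qed

lemma carrier_quot: "carrier (quot G A B) = (\<lambda>a. B #>\<^bsub>G\<^esub> a) ` A"
  by (simp add: quot_def carrier_FactGroup r_coset_def[abs_def])

lemma one_quot [simp]: "\<one>\<^bsub>quot G A B\<^esub> = B"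
  by (simp add: quot_def)

lemma mult_quot: "monoid.mult (quot G A B) = set_mult G"
  by (simp add: quot_def set_mult_def fun_eq_iff)

context group_hom
begin

lemma hom_commutator:
  "x \<in> carrier G \<Longrightarrow> y \<in> carrier G \<Longrightarrow> h (commutator G x y) = commutator H (h x) (h y)"
  by (simp add: commutator_def)

text \<open>A homomorphism carries the generating commutators onto the generating
  commutators.\<close>

lemma comm_sub_image:
  assumes "U \<subseteq> carrier G" "V \<subseteq> carrier G"
  shows "h ` comm_sub G U V = comm_sub H (h ` U) (h ` V)"
proof -
  have "h ` {commutator G u v |u v. u \<in> U \<and> v \<in> V} =
      {commutator H u v |u v. u \<in> h ` U \<and> v \<in> h ` V}" (is "?L = ?R")
  proof -
    have "?L = (\<lambda>(u, v). h (commutator G u v)) ` (U \<times> V)" by auto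
    also have "\<dots> = (\<lambda>(u, v). commutator H (h u) (h v)) ` (U \<times> V)"
      using assms by (intro image_cong refl) (auto simp: hom_commutator subsetD)
    also have "\<dots> = ?R" by auto
    finally show ?thesis .
  qed
  moreover have "{commutator G u v |u v. u \<in> U \<and> v \<in> V} \<subseteq> carrier G"
    using assms by auto
  ultimately show ?thesis unfolding comm_sub_commutator by (simp flip: generate_img)
qed

lemma gamma_image:
  assumes "h ` carrier G = carrier H"
  shows "h ` gamma G n = gamma H n"
proof (induction n)
  case (Suc n)
  have "gamma G n \<subseteq> carrier G" using G.normal_carrier[OF G.gamma_normal] by blast
  thus ?case using Suc by (cases n) (simp_all add: assms comm_sub_image)
qed (simp add: assms)

end

section \<open>Exponents and generators of factor groups\<close>

context group
begin

text \<open>Through this projection, powers and generated subgroups in \<open>quot G A B\<close> are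
  computed with elements of \<open>G\<close>.\<close>

lemma group_hom_quot:
  assumes B: "B \<lhd> G" and A: "subgroup A G" "B \<subseteq> A"
  shows "group_hom (G\<lparr>carrier := A\<rparr>) (quot G A B) (\<lambda>a. B #> a)"
proof -
  have "B \<lhd> G\<lparr>carrier := A\<rparr>" by (rule normal_restrict_supergroup[OF A(1) B A(2)])
  hence "group (quot G A B)" unfolding quot_def by (rule normal.factorgroup_is_group)
  moreover have "(\<lambda>a. B #> a) \<in> hom (G\<lparr>carrier := A\<rparr>) (quot G A B)"
    using normal.rcos_sum[OF B] subgroup.mem_carrier[OF A(1)]
    by (auto simp: hom_def carrier_quot mult_quot)
  ultimately show ?thesis
    using subgroup_imp_group[OF A(1)] by (simp add: group_hom_def group_hom_axioms_def)
qed

lemma r_coset_eq_self_iff: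
  assumes "subgroup B G" "a \<in> carrier G" shows "B #> a = B \<longleftrightarrow> a \<in> B"
  using r_coset_eq_iff[OF assms one_closed] assms coset_mult_one[OF subgroup.subset[OF assms(1)]]
  by simp

text \<open>If no positive exponent exists, \<open>grp_exponent\<close> has the default value 0, and
  the zeroth power is trivial.\<close>

lemma grp_exponent_pow:
  assumes "x \<in> carrier G" shows "x [^] grp_exponent G = \<one>"
proof (cases "\<exists>n::nat>0. \<forall>x\<in>carrier G. x [^] n = \<one>")
  case True
  have "\<forall>x\<in>carrier G. x [^] grp_exponent G = \<one>"
    unfolding grp_exponent_def if_P[OF True] using LeastI_ex[OF True] by (rule conjunct2)
  thus ?thesis using assms by blast
next
  case False
  thus ?thesis unfolding grp_exponent_def if_not_P[OF False] by simp
qed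

text \<open>The remainder of \<open>n\<close> modulo the exponent also annihilates the group but is
  smaller than the least positive such number, so it is 0.\<close>

lemma grp_exponent_dvd:
  assumes "\<And>x. x \<in> carrier G \<Longrightarrow> x [^] (n::nat) = \<one>"
  shows "grp_exponent G dvd n"
proof (cases "n = 0")
  case False
  let ?P = "\<lambda>n::nat. n > 0 \<and> (\<forall>x\<in>carrier G. x [^] n = \<one>)"
  let ?e = "grp_exponent G"
  have "?P n" using False assms by simp
  hence e: "?e = (LEAST n. ?P n)" unfolding grp_exponent_def by (intro if_P exI)
  have pos: "?e > 0" unfolding e using LeastI[of ?P, OF \<open>?P n\<close>] by blast
  have "x [^] (n mod ?e) = \<one>" if x: "x \<in> carrier G" for x
  proof -
    have "\<one> = x [^] (?e * (n div ?e) + n mod ?e)" using assms x by simp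
    also have "\<dots> = (x [^] ?e) [^] (n div ?e) \<otimes> x [^] (n mod ?e)"
      using x by (simp only: nat_pow_mult nat_pow_pow)
    also have "\<dots> = x [^] (n mod ?e)" using x by (simp add: grp_exponent_pow)
    finally show ?thesis by simp
  qed
  moreover have "\<not> ?P (n mod ?e)"
    using not_less_Least[of "n mod ?e" ?P] pos by (simp flip: e)
  ultimately show ?thesis by (simp add: dvd_eq_mod_eq_0)
qed simp

lemma pow_mem_iff_quot:
  assumes B: "B \<lhd> G" and A: "subgroup A G" "B \<subseteq> A" and a: "a \<in> A"
  shows "(B #> a) [^]\<^bsub>quot G A B\<^esub> (n::nat) = \<one>\<^bsub>quot G A B\<^esub> \<longleftrightarrow> a [^] n \<in> B"
proof -
  interpret Q: group_hom "G\<lparr>carrier := A\<rparr>" "quot G A B" "\<lambda>a. B #> a"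
    by (rule group_hom_quot[OF B A])
  have "(B #> a) [^]\<^bsub>quot G A B\<^esub> n = B #> (a [^] n)"
    using Q.hom_nat_pow[of a n] a by (simp flip: nat_pow_consistent)
  thus ?thesis
    using r_coset_eq_self_iff[OF normal_imp_subgroup[OF B]] a subgroup.mem_carrier[OF A(1)] by simp
qed

lemma pow_grp_exponent_quot:
  assumes "B \<lhd> G" "subgroup A G" "B \<subseteq> A" "a \<in> A"
  shows "a [^] grp_exponent (quot G A B) \<in> B"
proof -
  interpret Q: group_hom "G\<lparr>carrier := A\<rparr>" "quot G A B" "\<lambda>a. B #> a"
    by (rule group_hom_quot[OF assms(1-3)])
  show ?thesis
    using Q.H.grp_exponent_pow[of "B #> a"] assms pow_mem_iff_quot[OF assms] by (simp add: carrier_quot)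
qed

lemma grp_exponent_quot_dvd:
  assumes "B \<lhd> G" "subgroup A G" "B \<subseteq> A" "\<And>a. a \<in> A \<Longrightarrow> a [^] (n::nat) \<in> B"
  shows "grp_exponent (quot G A B) dvd n"
proof -
  interpret Q: group_hom "G\<lparr>carrier := A\<rparr>" "quot G A B" "\<lambda>a. B #> a"
    by (rule group_hom_quot[OF assms(1-3)])
  show ?thesis
    using assms(4) pow_mem_iff_quot[OF assms(1-3)]
    by (intro Q.H.grp_exponent_dvd) (auto simp: carrier_quot)
qed

lemma quot_image_generate:
  assumes "B \<lhd> G" "subgroup A G" "B \<subseteq> A" "Y \<subseteq> A"
  shows "generate (quot G A B) ((\<lambda>a. B #> a) ` Y) = (\<lambda>a. B #> a) ` generate G Y"
proof -
  interpret Q: group_hom "G\<lparr>carrier := A\<rparr>" "quot G A B" "\<lambda>a. B #> a"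
    by (rule group_hom_quot[OF assms(1-3)])
  show ?thesis
    using Q.generate_img[of Y] assms(4) generate_consistent[OF assms(4,2)] by simp
qed

text \<open>Elements of \<open>B\<close> become the trivial coset, and elements of one coset differ
  by elements of \<open>B\<close>. This allows generators of factor groups to be handled inside
  \<open>G\<close>.\<close>

lemma quot_generators_iff:
  assumes B: "B \<lhd> G" and A: "subgroup A G" "B \<subseteq> A" and S: "S \<subseteq> A"
  shows "generate (quot G A B) ((\<lambda>a. B #> a) ` S) = carrier (quot G A B)
    \<longleftrightarrow> A \<subseteq> generate G (S \<union> B)"
proof
  interpret Q: group_hom "G\<lparr>carrier := A\<rparr>" "quot G A B" "\<lambda>a. B #> a"
    by (rule group_hom_quot[OF B A])
  have Bs: "subgroup B G" using B by (rule normal_imp_subgroup)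
  note AG = subgroup.mem_carrier[OF A(1)]
  {
    assume "generate (quot G A B) ((\<lambda>a. B #> a) ` S) = carrier (quot G A B)"
    hence *: "(\<lambda>a. B #> a) ` generate G S = (\<lambda>a. B #> a) ` A"
      using quot_image_generate[OF B A S] by (simp add: carrier_quot)
    show "A \<subseteq> generate G (S \<union> B)"
    proof
      fix a assume a: "a \<in> A"
      then obtain g where g: "g \<in> generate G S" "B #> a = B #> g" using * by blast
      have gG: "g \<in> carrier G" using g S AG by (blast intro: generate_in_carrier)
      have "a \<otimes> inv g \<in> generate G (S \<union> B)"
        using g gG a AG r_coset_eq_iff[OF Bs] by (intro generate.incl) auto
      moreover have "g \<in> generate G (S \<union> B)" using g mono_generate[of S "S \<union> B"] by auto
      ultimately have "a \<otimes> inv g \<otimes> g \<in> generate G (S \<union> B)" by (rule generate.eng)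
      thus "a \<in> generate G (S \<union> B)" using a gG AG by (simp add: m_assoc)
    qed
  }
  assume le: "A \<subseteq> generate G (S \<union> B)"
  let ?g = "generate (quot G A B) ((\<lambda>a. B #> a) ` S)"
  have SQ: "(\<lambda>a. B #> a) ` S \<subseteq> carrier (quot G A B)" using S by (auto simp: carrier_quot)
  have "carrier (quot G A B) \<subseteq> (\<lambda>a. B #> a) ` generate G (S \<union> B)"
    using le by (auto simp: carrier_quot)
  also have "\<dots> = generate (quot G A B) ((\<lambda>a. B #> a) ` (S \<union> B))"
    using S A by (simp add: quot_image_generate[OF B A])
  also have "\<dots> \<subseteq> ?g"
  proof (rule Q.H.generate_subgroup_incl[OF _ Q.H.generate_is_subgroup[OF SQ]])
    show "(\<lambda>a. B #> a) ` (S \<union> B) \<subseteq> ?g"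
      using generate.one[of "quot G A B"] subgroup.rcos_const[OF Bs is_group]
      by (auto intro: generate.incl)
  qed
  finally show "?g = carrier (quot G A B)" using Q.H.generate_incl[OF SQ] by blast
qed

lemma min_gens_quot_le:
  assumes "B \<lhd> G" "subgroup A G" "B \<subseteq> A" "S \<subseteq> A" "finite S" "A \<subseteq> generate G (S \<union> B)"
  shows "min_gens (quot G A B) \<le> card S"
proof -
  have "generate (quot G A B) ((\<lambda>a. B #> a) ` S) = carrier (quot G A B)"
    using quot_generators_iff assms by blast
  hence "min_gens (quot G A B) \<le> card ((\<lambda>a. B #> a) ` S)"
    unfolding min_gens_def using assms(4,5)
    by (intro Least_le exI[of _ "(\<lambda>a. B #> a) ` S"]) (auto simp: carrier_quot)
  thus ?thesis using card_image_le[OF assms(5), of "\<lambda>a. B #> a"] by simp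
qed

text \<open>\<open>min_gens\<close> is an unspecified number for groups that are not finitely generated, hence the
  generating set \<open>S\<close> among the hypotheses.\<close>
lemma min_gens_quot_generators:
  assumes "B \<lhd> G" "subgroup A G" "B \<subseteq> A" "S \<subseteq> A" "finite S" "A \<subseteq> generate G (S \<union> B)"
  shows "\<exists>S'\<subseteq>A. finite S' \<and> card S' = min_gens (quot G A B) \<and> A \<subseteq> generate G (S' \<union> B)"
proof -
  let ?P = "\<lambda>n. \<exists>Y. Y \<subseteq> carrier (quot G A B) \<and> finite Y \<and> card Y = n \<and>
    generate (quot G A B) Y = carrier (quot G A B)"
  have "generate (quot G A B) ((\<lambda>a. B #> a) ` S) = carrier (quot G A B)"
    using quot_generators_iff assms by blast
  hence "?P (card ((\<lambda>a. B #> a) ` S))"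
    using assms(4,5) by (intro exI[of _ "(\<lambda>a. B #> a) ` S"]) (auto simp: carrier_quot)
  hence "?P (min_gens (quot G A B))" unfolding min_gens_def by (rule LeastI)
  then obtain Y where Y: "Y \<subseteq> (\<lambda>a. B #> a) ` A" "finite Y" "card Y = min_gens (quot G A B)"
    "generate (quot G A B) Y = carrier (quot G A B)" by (auto simp: carrier_quot)
  \<comment> \<open>One representative for each coset in \<open>Y\<close>, so that the cardinality
    is kept.\<close>
  obtain S' where S': "S' \<subseteq> A" "inj_on (\<lambda>a. B #> a) S'" "Y = (\<lambda>a. B #> a) ` S'"
    using Y(1) unfolding subset_image_inj by blast
  have "A \<subseteq> generate G (S' \<union> B)" using quot_generators_iff[OF assms(1-3) S'(1)] Y(4) S'(3) by blast
  moreover have "finite S'" "card S' = card Y"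
    using S' Y(2) by (auto simp: card_image dest: finite_imageD)
  ultimately show ?thesis using S'(1) Y(3) by auto
qed

section \<open>Indices, exponents and generators along a chain\<close>

text \<open>On \<open>A\<close> the map \<open>f\<close> has the same fibres as the coset map. It is
  used with a map into pairs of cosets and with the projection of a presentation.\<close>

lemma order_quot_eq_card_image:
  assumes "subgroup N G" "A \<subseteq> carrier G"
    and "\<And>x y. x \<in> A \<Longrightarrow> y \<in> A \<Longrightarrow> f x = f y \<longleftrightarrow> x \<otimes> inv y \<in> N"
  shows "order (quot G A N) = card (f ` A)"
  unfolding order_def carrier_quot
proof (rule card_image_cong_ker)
  fix x y assume xy: "x \<in> A" "y \<in> A"
  hence "x \<in> carrier G" "y \<in> carrier G" using assms(2) by auto
  thus "N #> x = N #> y \<longleftrightarrow> f x = f y"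
    using assms(3)[OF xy] r_coset_eq_iff[OF assms(1)] by blast
qed

text \<open>A coset of \<open>C\<close> is determined by the coset of \<open>B\<close> containing it
  and by its position relative to a chosen representative. Counting pairs also covers infinite
  indices, which \<open>card\<close> counts as 0.\<close>

lemma order_quot_tower:
  assumes A: "subgroup A G" and B: "subgroup B G" "B \<subseteq> A" and C: "subgroup C G" "C \<subseteq> B"
  shows "order (quot G A C) = order (quot G A B) * order (quot G B C)"
proof -
  note AG = subgroup.mem_carrier[OF A]
  \<comment> \<open>\<open>r\<close> picks in \<open>A\<close> a representative of each coset of
    \<open>B\<close> that meets \<open>A\<close>.\<close>
  define r where "r P = inv_into A (\<lambda>a. B #> a) P" for P
  have r: "r (B #> a) \<in> A" "B #> r (B #> a) = B #> a" if "a \<in> A" for a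
    using that inv_into_into[of "B #> a" "\<lambda>a. B #> a" A] f_inv_into_f[of "B #> a" "\<lambda>a. B #> a" A]
    unfolding r_def by blast+
  have rB: "a \<otimes> inv (r (B #> a)) \<in> B" if "a \<in> A" for a
    using r(2)[OF that] r_coset_eq_iff[OF B(1) AG[OF that] AG[OF r(1)[OF that]]] by simp
  let ?f = "\<lambda>a. (B #> a, C #> (a \<otimes> inv (r (B #> a))))"
  have img: "?f ` A = (\<lambda>a. B #> a) ` A \<times> (\<lambda>b. C #> b) ` B"
  proof
    show "?f ` A \<subseteq> (\<lambda>a. B #> a) ` A \<times> (\<lambda>b. C #> b) ` B"
      by (intro image_subsetI SigmaI imageI rB)
    show "(\<lambda>a. B #> a) ` A \<times> (\<lambda>b. C #> b) ` B \<subseteq> ?f ` A"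
    proof clarify
      fix a b assume a: "a \<in> A" and b: "b \<in> B"
      have rA: "r (B #> a) \<in> A" by (rule r(1)[OF a])
      let ?x = "b \<otimes> r (B #> a)"
      have x: "?x \<in> A" using b B(2) rA subgroup.m_closed[OF A] by blast
      have "B #> ?x = B #> r (B #> a)"
        using b B(2) rA AG x by (subst r_coset_eq_iff[OF B(1)]) (auto simp: m_assoc)
      hence Bx: "B #> ?x = B #> a" using r(2)[OF a] by simp
      have "?f ?x = (B #> a, C #> b)"
        unfolding Bx using b B(2) rA AG by (auto simp: m_assoc)
      thus "(B #> a, C #> b) \<in> ?f ` A" using imageI[OF x, of ?f] by (simp only:)
    qed
  qed
  have "order (quot G A C) = card (?f ` A)"
  proof (rule order_quot_eq_card_image[OF C(1)])
    fix x y assume x: "x \<in> A" and y: "y \<in> A"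
    \<comment> \<open>For equal cosets of \<open>B\<close> the representatives agree and
      cancel.\<close>
    have "C #> (x \<otimes> inv (r (B #> x))) = C #> (y \<otimes> inv (r (B #> x))) \<longleftrightarrow> x \<otimes> inv y \<in> C"
      using x y r(1)[OF x] AG by (subst r_coset_eq_iff[OF C(1)]) (auto simp: m_assoc inv_mult_group)
    moreover have "x \<otimes> inv y \<in> C \<Longrightarrow> B #> x = B #> y"
      using C(2) r_coset_eq_iff[OF B(1) AG[OF x] AG[OF y]] by blast
    ultimately show "?f x = ?f y \<longleftrightarrow> x \<otimes> inv y \<in> C" unfolding prod.inject by metis
  qed (intro subgroup.subset[OF A])
  thus ?thesis unfolding img card_cartesian_product by (simp add: order_def carrier_quot)
qed

lemma order_quot_chain:
  assumes A: "\<And>k. subgroup (A k) G" "\<And>k. A (Suc k) \<subseteq> A k"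
  shows "order (quot G (A 0) (A n)) = (\<Prod>k<n. order (quot G (A k) (A (Suc k))))"
proof (induction n)
  case 0
  have "(\<lambda>a. A 0 #> a) ` A 0 = {A 0}"
    using image_constant[OF subgroup.one_closed[OF A(1)[of 0]], of "A 0"]
      subgroup.rcos_const[OF A(1)[of 0] is_group] by (simp cong: image_cong)
  thus ?case by (simp add: order_def carrier_quot)
next
  case (Suc n)
  have "A n \<subseteq> A 0" by (rule lift_Suc_antimono_le[of A, OF A(2)]) simp
  thus ?case using order_quot_tower[OF A(1)[of 0] A(1)[of n] _ A(1)[of "Suc n"] A(2)[of n]] Suc
    by simp
qed

text \<open>Each further exponent pushes the power one term down the chain.\<close>

lemma pow_prod_grp_exponent_chain:
  assumes A: "\<And>k. A k \<lhd> G" "\<And>k. A (Suc k) \<subseteq> A k" and a: "a \<in> A 0"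
  shows "a [^] (\<Prod>k<n. grp_exponent (quot G (A k) (A (Suc k)))) \<in> A n"
proof (induction n)
  case 0
  show ?case using a normal_carrier[OF A(1) a] by simp
next
  case (Suc n)
  have "a [^] (\<Prod>k<Suc n. grp_exponent (quot G (A k) (A (Suc k)))) =
    (a [^] (\<Prod>k<n. grp_exponent (quot G (A k) (A (Suc k))))) [^]
      grp_exponent (quot G (A n) (A (Suc n)))"
    using a normal_carrier[OF A(1) a] by (simp add: nat_pow_pow)
  thus ?case
    using pow_grp_exponent_quot[OF A(1) normal_imp_subgroup[OF A(1)] A(2) Suc] by simp
qed

text \<open>Intersect the chain with \<open>C\<close>: each factor of the new chain embeds in a
  central factor of the old one, so \<open>subgroup_generators_mod_central\<close> bounds its
  generators by \<open>card (S k)\<close>.\<close>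

lemma subgroup_generators_central_chain:
  assumes A: "\<And>k. A k \<lhd> G" and central: "\<And>k. comm_sub G (A k) (carrier G) \<subseteq> A (Suc k)"
    and S: "\<And>k. S k \<subseteq> A k" "\<And>k. finite (S k)" "\<And>k. A k \<subseteq> generate G (S k \<union> A (Suc k))"
    and C: "subgroup C G" "C \<subseteq> A 0"
  shows "\<exists>S'\<subseteq>C. finite S' \<and> card S' \<le> (\<Sum>k<n. card (S k)) \<and> C \<subseteq> generate G (S' \<union> (A n \<inter> C))"
proof (induction n)
  case 0
  have "C \<subseteq> generate G ({} \<union> (A 0 \<inter> C))" using C(2) by (auto intro: generate.incl)
  thus ?case by (intro exI[of _ "{}"]) simp
next
  case (Suc n)
  then obtain T where T: "T \<subseteq> C" "finite T" "card T \<le> (\<Sum>k<n. card (S k))"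
    "C \<subseteq> generate G (T \<union> (A n \<inter> C))" by blast
  have "\<exists>S'\<subseteq>A n \<inter> C. finite S' \<and> card S' \<le> card (S n) \<and>
      A n \<inter> C \<subseteq> generate G (S' \<union> (A (Suc n) \<inter> (A n \<inter> C)))"
  proof (rule subgroup_generators_mod_central[OF A S(2)])
    show "S n \<subseteq> carrier G" using S(1) normal_carrier[OF A] by blast
    show "commutator G s x \<in> A (Suc n)" if "s \<in> S n" "x \<in> carrier G" for s x
      using that S(1) central[of n] comm_sub_incl[of s "A n" x "carrier G" G] by blast
    show "subgroup (A n \<inter> C) G" using normal_imp_subgroup[OF A] C(1) by (rule subgroups_Inter_pair)
    show "A n \<inter> C \<subseteq> generate G (S n \<union> A (Suc n))" using S(3) by blast
  qed
  then obtain T' where T': "T' \<subseteq> A n \<inter> C" "finite T'" "card T' \<le> card (S n)"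
    "A n \<inter> C \<subseteq> generate G (T' \<union> (A (Suc n) \<inter> (A n \<inter> C)))" by blast
  let ?X = "T \<union> T' \<union> (A (Suc n) \<inter> C)"
  have "?X \<subseteq> carrier G" using T(1) T'(1) subgroup.mem_carrier[OF C(1)] by blast
  hence Y: "subgroup (generate G ?X) G" by (rule generate_is_subgroup)
  have "A n \<inter> C \<subseteq> generate G ?X"
    by (rule order_trans[OF T'(4) mono_generate]) blast
  moreover have "T \<subseteq> generate G ?X" by (auto intro: generate.incl)
  ultimately have "generate G (T \<union> (A n \<inter> C)) \<subseteq> generate G ?X"
    by (intro generate_subgroup_incl[OF _ Y]) blast
  hence "C \<subseteq> generate G ?X" using T(4) by blast
  moreover have "card (T \<union> T') \<le> (\<Sum>k<Suc n. card (S k))"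
    using card_Un_le[of T T'] T(3) T'(3) by simp
  ultimately show ?case using T T' by (intro exI[of _ "T \<union> T'"]) auto
qed

section \<open>The normal subgroups gamma_k(G)R\<close>

lemma gamma_mult_normal: "R \<lhd> G \<Longrightarrow> gamma G k <#> R \<lhd> G"
  by (intro normal_subgroup_set_mult_closed gamma_normal)

lemma gamma_mult_Suc_subset: "gamma G (Suc k) <#> R \<subseteq> gamma G k <#> R"
  by (rule mono_set_mult[OF gamma_Suc_subset order_refl])

lemma subset_gamma_mult:
  assumes "R \<lhd> G" shows "R \<subseteq> gamma G k <#> R"
proof
  fix x assume x: "x \<in> R"
  have "\<one> \<otimes> x \<in> gamma G k <#> R"
    unfolding set_mult_def using x normal_subgroup_closed(3)[OF gamma_normal] by blast
  thus "x \<in> gamma G k <#> R" using normal_carrier[OF assms x] by simp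
qed

lemma gamma_subset_gamma_mult:
  assumes "R \<lhd> G" shows "gamma G k \<subseteq> gamma G k <#> R"
proof
  fix x assume x: "x \<in> gamma G k"
  have "x \<otimes> \<one> \<in> gamma G k <#> R"
    unfolding set_mult_def using x normal_subgroup_closed(3)[OF assms] by blast
  thus "x \<in> gamma G k <#> R" using normal_carrier[OF gamma_normal x] by simp
qed

lemma gamma_mult_absorb:
  assumes "R \<lhd> G" "gamma G k \<subseteq> R" shows "gamma G k <#> R = R"
proof
  show "gamma G k <#> R \<subseteq> R"
  proof
    fix x assume "x \<in> gamma G k <#> R"
    then obtain a r where "a \<in> R" "r \<in> R" "x = a \<otimes> r"
      unfolding set_mult_def using assms(2) by auto
    thus "x \<in> R" by (simp add: normal_subgroup_closed(1)[OF assms(1)])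
  qed
qed (rule subset_gamma_mult[OF assms(1)])

text \<open>[a r, v] is the conjugate of [a, v] by \<open>r\<close>, lying in gamma_{k+1}(G), times
  [r, v], lying in \<open>R\<close>. The bound on \<open>k\<close> reflects that the recursion of
  \<open>gamma\<close> starts at index 1.\<close>

lemma comm_sub_gamma_mult_subset:
  assumes R: "R \<lhd> G" and k: "k \<ge> 1"
  shows "comm_sub G (gamma G k <#> R) (carrier G) \<subseteq> gamma G (Suc k) <#> R"
proof -
  have sg: "subgroup (gamma G (Suc k) <#> R) G"
    by (rule normal_imp_subgroup[OF gamma_mult_normal[OF R]])
  have "commutator G u v \<in> gamma G (Suc k) <#> R" if u: "u \<in> gamma G k <#> R" and v: "v \<in> carrier G"
    for u v
  proof -
    obtain a r where a: "a \<in> gamma G k" and r: "r \<in> R" and ar: "u = a \<otimes> r"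
      using u unfolding set_mult_def by blast
    note c = normal_carrier[OF gamma_normal a] normal_carrier[OF R r]
    have "commutator G a v \<in> gamma G (Suc k)"
      unfolding gamma_Suc[OF k] using a v by (rule comm_sub_incl)
    hence "inv r \<otimes> commutator G a v \<otimes> r \<in> gamma G (Suc k)"
      by (rule normal_conj_inv_left[OF gamma_normal c(2)])
    moreover have "commutator G r v \<in> R"
      using comm_sub_subset_left[OF R order_refl] comm_sub_incl[OF r v] by (rule subsetD)
    ultimately have "(inv r \<otimes> commutator G a v \<otimes> r) \<otimes> commutator G r v \<in> gamma G (Suc k) <#> R"
      unfolding set_mult_def by blast
    thus ?thesis unfolding ar commutator_mult_left[OF c v] .
  qed
  thus ?thesis unfolding comm_sub_subset_iff[OF sg] by blast
qed

text \<open>\<open>A\<close> meets only finitely many cosets of \<open>R\<close>, and one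
  representative of each suffices.\<close>

lemma finite_index_generators:
  assumes R: "subgroup R G" and fin: "finite (rcosets R)" and A: "A \<subseteq> carrier G"
  shows "\<exists>S\<subseteq>A. finite S \<and> A \<subseteq> generate G (S \<union> R)"
proof -
  have "(\<lambda>a. R #> a) ` A \<subseteq> rcosets R" using A by (auto simp: RCOSETS_def)
  hence "finite ((\<lambda>a. R #> a) ` A)" using fin by (rule finite_subset)
  then obtain S where S: "S \<subseteq> A" "finite S" "(\<lambda>a. R #> a) ` A = (\<lambda>a. R #> a) ` S"
    using finite_subset_image[of "(\<lambda>a. R #> a) ` A" "\<lambda>a. R #> a" A] by blast
  have "a \<in> generate G (S \<union> R)" if a: "a \<in> A" for a
  proof -
    obtain s where s: "s \<in> S" "R #> a = R #> s" using S(3) a by blast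
    have c: "a \<in> carrier G" "s \<in> carrier G" using a s(1) S(1) A by auto
    have "a \<otimes> inv s \<in> R" using r_coset_eq_iff[OF R c] s(2) by blast
    hence "a \<otimes> inv s \<otimes> s \<in> generate G (S \<union> R)"
      using s(1) by (intro generate.eng generate.incl) auto
    thus ?thesis using c by (simp add: m_assoc)
  qed
  thus ?thesis using S(1,2) by blast
qed

end

section \<open>The chain of iterated commutators of gamma_k(G)R\<close>

text \<open>\<open>lower_term G R i k\<close> is \<open>[\<gamma>\<^sub>k\<^sub>+\<^sub>1(G)R, \<^sub>iG]\<close>, indexed from \<open>k = 0\<close>.\<close>
definition lower_term :: "('a, 'm) monoid_scheme \<Rightarrow> 'a set \<Rightarrow> nat \<Rightarrow> nat \<Rightarrow> 'a set" where
  "lower_term G R i k = iter_comm G (gamma G (Suc k) <#>\<^bsub>G\<^esub> R) i (carrier G)"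

context group
begin

lemma lower_term_normal: "R \<lhd> G \<Longrightarrow> lower_term G R i k \<lhd> G"
  unfolding lower_term_def by (intro iter_comm_normal gamma_mult_normal)

lemma lower_term_Suc_subset: "lower_term G R i (Suc k) \<subseteq> lower_term G R i k"
  unfolding lower_term_def by (intro iter_comm_mono gamma_mult_Suc_subset)

lemma comm_sub_lower_term: "comm_sub G (lower_term G R i k) (carrier G) = lower_term G R (Suc i) k"
  by (simp add: lower_term_def)

text \<open>The innermost bracket takes gamma_{k+1}(G)R into gamma_{k+2}(G)R, and the remaining
  \<open>i\<close> brackets are monotone. This is the centrality of the factors of the
  chain.\<close>

lemma lower_term_central:
  assumes "R \<lhd> G" shows "lower_term G R (Suc i) k \<subseteq> lower_term G R i (Suc k)"
  unfolding lower_term_def iter_comm_Suc_left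
  by (intro iter_comm_mono comm_sub_gamma_mult_subset assms) simp

lemma lower_term_0:
  assumes "R \<lhd> G" shows "lower_term G R i 0 = gamma G (Suc i)"
proof -
  have "carrier G <#> R = carrier G"
  proof
    show "carrier G <#> R \<subseteq> carrier G"
      using normal_carrier[OF gamma_mult_normal[OF assms, of 0]] by auto
    show "carrier G \<subseteq> carrier G <#> R"
      using gamma_subset_gamma_mult[OF assms, of 0] by simp
  qed
  thus ?thesis by (simp add: lower_term_def iter_comm_carrier)
qed

text \<open>Every term lies in gamma_{i+1}(G), whose commutators with \<open>R\<close> lie in
  \<open>iter_comm G R (Suc i) (carrier G)\<close>, which is contained in every term. So entries
  from \<open>R\<close> vanish modulo any term.\<close>

lemma comm_sub_lower_term_subset:
  assumes R: "R \<lhd> G"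
  shows "comm_sub G (lower_term G R i k) R \<subseteq> lower_term G R (Suc i) l"
proof -
  have "lower_term G R i k \<subseteq> lower_term G R i 0"
    by (rule lift_Suc_antimono_le[of "lower_term G R i", OF lower_term_Suc_subset]) simp
  hence "comm_sub G (lower_term G R i k) R \<subseteq> comm_sub G (gamma G (Suc i)) R"
    unfolding lower_term_0[OF R] by (rule comm_sub_mono) simp
  also have "\<dots> \<subseteq> iter_comm G R (Suc i) (carrier G)" by (rule comm_sub_gamma_subset[OF R])
  also have "\<dots> \<subseteq> lower_term G R (Suc i) l"
    unfolding lower_term_def by (intro iter_comm_mono subset_gamma_mult R)
  finally show ?thesis .
qed

text \<open>Induction on the number of brackets. Without brackets the finite index of
  \<open>R\<close> gives the generators; each further bracket is \<open>comm_sub_generated\<close>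
  with \<open>U'\<close> the next term of the chain and \<open>Z\<close> equal to
  \<open>R\<close>.\<close>

lemma lower_term_generators:
  assumes R: "R \<lhd> G" and fin: "finite (rcosets R)"
  shows "\<exists>S\<subseteq>lower_term G R i k. finite S \<and>
           lower_term G R i k \<subseteq> generate G (S \<union> lower_term G R i (Suc k))"
proof (induction i)
  have Rs: "subgroup R G" by (rule normal_imp_subgroup[OF R])
  case 0
  have "lower_term G R 0 k \<subseteq> carrier G" using normal_carrier[OF lower_term_normal[OF R]] by blast
  then obtain S where S: "S \<subseteq> lower_term G R 0 k" "finite S"
    "lower_term G R 0 k \<subseteq> generate G (S \<union> R)"
    using finite_index_generators[OF Rs fin] by blast
  have "S \<union> R \<subseteq> S \<union> lower_term G R 0 (Suc k)"
    using subset_gamma_mult[OF R, of "Suc (Suc k)"] by (auto simp: lower_term_def simp del: gamma.simps)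
  hence "lower_term G R 0 k \<subseteq> generate G (S \<union> lower_term G R 0 (Suc k))"
    using S(3) mono_generate by (metis order_trans)
  thus ?case using S by blast
next
  case (Suc i)
  then obtain S where S: "S \<subseteq> lower_term G R i k" "finite S"
    "lower_term G R i k \<subseteq> generate G (S \<union> lower_term G R i (Suc k))" by blast
  obtain T where T: "T \<subseteq> carrier G" "finite T" "carrier G \<subseteq> generate G (T \<union> R)"
    using finite_index_generators[OF normal_imp_subgroup[OF R] fin order_refl] by blast
  let ?S = "(\<lambda>(s, t). commutator G s t) ` (S \<times> T)"
  have "comm_sub G (lower_term G R i k) (carrier G) \<subseteq>
      generate G (?S \<union> lower_term G R (Suc i) (Suc k))"
  proof (rule comm_sub_generated[OF lower_term_normal[OF R] lower_term_normal[OF R] S(1,3) _ T(1,3)])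
    show "lower_term G R i (Suc k) \<subseteq> lower_term G R i k" by (rule lower_term_Suc_subset)
    show "R \<subseteq> carrier G" using normal_carrier[OF R] by blast
    show "comm_sub G (lower_term G R i k) R \<subseteq> lower_term G R (Suc i) (Suc k)"
      by (rule comm_sub_lower_term_subset[OF R])
    show "comm_sub G (comm_sub G (lower_term G R i k) (carrier G)) (carrier G)
        \<subseteq> lower_term G R (Suc i) (Suc k)"
      unfolding comm_sub_lower_term by (rule lower_term_central[OF R])
  qed (simp add: comm_sub_lower_term)
  moreover have "?S \<subseteq> lower_term G R (Suc i) k"
    unfolding comm_sub_lower_term[symmetric] using S(1) T(1) by (auto intro: comm_sub_incl)
  moreover have "finite ?S" using S(2) T(2) by simp
  ultimately show ?case unfolding comm_sub_lower_term by blast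
qed

end

section \<open>Orders, exponents and generator numbers of the multipliers\<close>

theorem theorem24:
  fixes G :: "'g monoid" and F :: "'f monoid" and R :: "'f set" and c t :: nat
  assumes "c \<ge> 1"
    and "group G" and "finite (carrier G)"
    and "t \<ge> 2" and "nilpotent_class G t"
    and "free_group F" and "R \<lhd> F" and "F Mod R \<cong> G"
  shows
    "(card (gamma G (Suc c)) * order (c_multiplier c F R) =
       order (c_multiplier c F (gamma F 2 <#>\<^bsub>F\<^esub> R)) *
       (\<Prod>k=1..t-1. order (quot F (iter_comm F (gamma F (k+1) <#>\<^bsub>F\<^esub> R) c (carrier F))
                                   (iter_comm F (gamma F (k+2) <#>\<^bsub>F\<^esub> R) c (carrier F))))) \<and>
    (grp_exponent (c_multiplier c F R) dvd
       grp_exponent (c_multiplier c F (gamma F 2 <#>\<^bsub>F\<^esub> R)) *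
       (\<Prod>k=1..t-1. grp_exponent (quot F (iter_comm F (gamma F (k+1) <#>\<^bsub>F\<^esub> R) c (carrier F))
                                   (iter_comm F (gamma F (k+2) <#>\<^bsub>F\<^esub> R) c (carrier F))))) \<and>
    (min_gens (c_multiplier c F R) \<le>
       min_gens (c_multiplier c F (gamma F 2 <#>\<^bsub>F\<^esub> R)) +
       (\<Sum>k=1..t-1. min_gens (quot F (iter_comm F (gamma F (k+1) <#>\<^bsub>F\<^esub> R) c (carrier F))
                                   (iter_comm F (gamma F (k+2) <#>\<^bsub>F\<^esub> R) c (carrier F)))))"
proof -
  interpret F: group F using assms(6) by (auto simp: free_group_def free_group_on_def)
  interpret R: normal R F by (rule assms(7))
  note N = assms(7)
  \<comment> \<open>Composing this isomorphism with the coset map gives the projection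
    \<open>\<phi>\<close> from \<open>F\<close> onto \<open>G\<close>; \<open>\<phi>_eq\<close> says
    that its kernel is \<open>R\<close>.\<close>
  obtain \<psi> where \<psi>: "\<psi> \<in> iso (F Mod R) G" using assms(8) unfolding is_iso_def by blast
  define \<phi> where "\<phi> x = \<psi> (R #>\<^bsub>F\<^esub> x)" for x
  have \<psi>_hom: "\<psi> \<in> hom (F Mod R) G" and \<psi>_bij: "bij_betw \<psi> (carrier (F Mod R)) (carrier G)"
    using \<psi> unfolding iso_def by blast+
  have "\<psi> \<circ> (\<lambda>x. R #>\<^bsub>F\<^esub> x) \<in> hom F G" by (rule hom_compose[OF R.r_coset_hom_Mod \<psi>_hom])
  hence "\<phi> \<in> hom F G" by (simp add: \<phi>_def[abs_def] comp_def)
  then interpret \<phi>: group_hom F G \<phi>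
    by (simp add: group_hom_def group_hom_axioms_def assms(2) F.is_group)
  have surj: "\<phi> ` carrier F = carrier G"
    using bij_betw_imp_surj_on[OF \<psi>_bij] unfolding carrier_FactGroup \<phi>_def image_image .
  have \<phi>_eq: "\<phi> x = \<phi> y \<longleftrightarrow> x \<otimes>\<^bsub>F\<^esub> inv\<^bsub>F\<^esub> y \<in> R" if "x \<in> carrier F" "y \<in> carrier F" for x y
  proof -
    have "\<phi> x = \<phi> y \<longleftrightarrow> R #>\<^bsub>F\<^esub> x = R #>\<^bsub>F\<^esub> y"
      unfolding \<phi>_def using that
      by (intro inj_on_eq_iff[OF bij_betw_imp_inj_on[OF \<psi>_bij]]) (auto simp: carrier_FactGroup)
    thus ?thesis using F.r_coset_eq_iff[OF R.subgroup_axioms that] by simp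
  qed
  have "finite (carrier (F Mod R))" using bij_betw_finite[OF \<psi>_bij] assms(3) by simp
  hence fin: "finite (rcosets\<^bsub>F\<^esub> R)" by (simp add: FactGroup_def)
  \<comment> \<open>The class of \<open>G\<close> fixes the length of the chain: gamma_{t+1}(F) maps
    to the trivial subgroup gamma_{t+1}(G).\<close>
  have gamma_t: "gamma F (Suc t) \<subseteq> R"
  proof
    fix x assume x: "x \<in> gamma F (Suc t)"
    have xF: "x \<in> carrier F" by (rule F.normal_carrier[OF F.gamma_normal x])
    have "\<phi> x \<in> gamma G (Suc t)" using x \<phi>.gamma_image[OF surj, of "Suc t"] by blast
    hence "\<phi> x = \<phi> \<one>\<^bsub>F\<^esub>" using assms(5) by (simp add: nilpotent_class_def)
    thus "x \<in> R" using \<phi>_eq[OF xF F.one_closed] xF by simp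
  qed

  \<comment> \<open>Indices are shifted by one against the overview: \<open>A k\<close> comes from
    gamma_{k+1}(F)R, so the chain runs from \<open>A 0\<close> to \<open>A t\<close>.\<close>
  define A where "A = lower_term F R c"
  define Q where "Q k = quot F (A k) (A (Suc k))" for k
  have A: "A k \<lhd> F" for k unfolding A_def by (rule F.lower_term_normal[OF N])
  have As: "subgroup (A k) F" for k by (rule normal_imp_subgroup[OF A])
  have A_Suc: "A (Suc k) \<subseteq> A k" for k unfolding A_def by (rule F.lower_term_Suc_subset)
  have A_0: "A 0 = gamma F (Suc c)" unfolding A_def by (rule F.lower_term_0[OF N])
  have A_t: "A t = iter_comm F R c (carrier F)"
    unfolding A_def lower_term_def F.gamma_mult_absorb[OF N gamma_t] ..
  have A_le: "A t \<subseteq> A 0" by (rule lift_Suc_antimono_le[of A, OF A_Suc]) simp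
  let ?C = "R \<inter> gamma F (Suc c)"
  have C: "subgroup ?C F"
    by (rule F.subgroups_Inter_pair[OF R.subgroup_axioms normal_imp_subgroup[OF F.gamma_normal]])
  have A_C: "A t \<subseteq> ?C"
    using A_le A_0 A_t F.iter_comm_antimono[OF N, of 0 c] by simp
  have mult_R: "c_multiplier c F R = quot F ?C (A t)"
    unfolding c_multiplier_def A_t ..
  have Q_eq: "quot F (iter_comm F (gamma F (k+1) <#>\<^bsub>F\<^esub> R) c (carrier F))
      (iter_comm F (gamma F (k+2) <#>\<^bsub>F\<^esub> R) c (carrier F)) = Q k" for k
    by (simp add: Q_def A_def lower_term_def)
  \<comment> \<open>G/G' is presented by gamma_2(F)R, which contains gamma_{c+1}(F) because
    \<open>c\<close> is positive; so the numerator of its multiplier is the whole of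
    \<open>A 0\<close>.\<close>
  have mult_Q: "c_multiplier c F (gamma F 2 <#>\<^bsub>F\<^esub> R) = Q 0"
  proof -
    have "gamma F (Suc c) \<subseteq> gamma F 2" using assms(1) by (intro F.gamma_antimono) simp
    hence "(gamma F 2 <#>\<^bsub>F\<^esub> R) \<inter> gamma F (Suc c) = A 0"
      using F.gamma_subset_gamma_mult[OF N, of 2] A_0 by blast
    thus ?thesis
      by (simp add: c_multiplier_def Q_def A_def lower_term_def numeral_2_eq_2)
  qed
  \<comment> \<open>The factor \<open>Q 0\<close> is separated because the products and the sum in
    the statement start at 1.\<close>
  have split: "{..<t} = insert 0 {1..t-1}" using assms(4) by auto

  \<comment> \<open>Claim (i): the index of \<open>A t\<close> in \<open>A 0\<close> is computed
    once along the chain and once through \<open>?C\<close>.\<close>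
  have "order (quot F (A 0) (A t)) = (\<Prod>k<t. order (Q k))"
    unfolding Q_def by (rule F.order_quot_chain[of A, OF As A_Suc])
  moreover have "order (quot F (A 0) (A t)) = order (quot F (A 0) ?C) * order (quot F ?C (A t))"
    by (rule F.order_quot_tower[OF As C _ As A_C]) (simp add: A_0)
  \<comment> \<open>The kernel of \<open>\<phi>\<close> restricted to \<open>A 0\<close> is
    \<open>?C\<close>, so this index is the size of the image, gamma_{c+1}(G).\<close>
  moreover have "order (quot F (A 0) ?C) = card (\<phi> ` A 0)"
  proof (rule F.order_quot_eq_card_image[OF C])
    show "A 0 \<subseteq> carrier F" by (rule subgroup.subset[OF As])
    fix x y assume xy: "x \<in> A 0" "y \<in> A 0"
    have c: "x \<in> carrier F" "y \<in> carrier F" using xy by (auto intro: F.normal_carrier[OF A])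
    have "x \<otimes>\<^bsub>F\<^esub> inv\<^bsub>F\<^esub> y \<in> gamma F (Suc c)"
      using xy subgroup.m_closed[OF As[of 0]] subgroup.m_inv_closed[OF As[of 0]] by (simp flip: A_0)
    thus "\<phi> x = \<phi> y \<longleftrightarrow> x \<otimes>\<^bsub>F\<^esub> inv\<^bsub>F\<^esub> y \<in> ?C" using \<phi>_eq[OF c] by simp
  qed
  moreover have "\<phi> ` A 0 = gamma G (Suc c)" unfolding A_0 by (rule \<phi>.gamma_image[OF surj])
  ultimately have 1: "card (gamma G (Suc c)) * order (quot F ?C (A t)) =
      order (Q 0) * (\<Prod>k=1..t-1. order (Q k))"
    unfolding split by simp

  \<comment> \<open>Claim (ii): elements of \<open>?C\<close> lie in \<open>A 0\<close>, and the
    product of the exponents takes them down to \<open>A t\<close>.\<close>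
  have "grp_exponent (quot F ?C (A t)) dvd (\<Prod>k<t. grp_exponent (Q k))"
  proof (rule F.grp_exponent_quot_dvd[OF A C A_C])
    fix a assume "a \<in> ?C"
    hence "a \<in> A 0" by (simp add: A_0)
    thus "a [^]\<^bsub>F\<^esub> (\<Prod>k<t. grp_exponent (Q k)) \<in> A t"
      unfolding Q_def by (rule F.pow_prod_grp_exponent_chain[of A, OF A A_Suc])
  qed
  hence 2: "grp_exponent (quot F ?C (A t)) dvd
      grp_exponent (Q 0) * (\<Prod>k=1..t-1. grp_exponent (Q k))"
    unfolding split by simp

  \<comment> \<open>Claim (iii): the factors are finitely generated by
    \<open>lower_term_generators\<close>, so each \<open>min_gens (Q k)\<close> is attained by an
    actual generating set.\<close>
  have "\<exists>S\<subseteq>A k. finite S \<and> card S = min_gens (Q k) \<and> A k \<subseteq> generate F (S \<union> A (Suc k))" for k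
  proof -
    obtain S where "S \<subseteq> A k" "finite S" "A k \<subseteq> generate F (S \<union> A (Suc k))"
      using F.lower_term_generators[OF N fin, of c k] unfolding A_def by blast
    thus ?thesis unfolding Q_def by (rule F.min_gens_quot_generators[OF A As A_Suc])
  qed
  then obtain S where S: "\<And>k. S k \<subseteq> A k" "\<And>k. finite (S k)" "\<And>k. card (S k) = min_gens (Q k)"
    "\<And>k. A k \<subseteq> generate F (S k \<union> A (Suc k))" by metis
  have central: "comm_sub F (A k) (carrier F) \<subseteq> A (Suc k)" for k
    unfolding A_def F.comm_sub_lower_term by (rule F.lower_term_central[OF N])
  have "\<exists>S'\<subseteq>?C. finite S' \<and> card S' \<le> (\<Sum>k<t. card (S k)) \<and> ?C \<subseteq> generate F (S' \<union> (A t \<inter> ?C))"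
    by (rule F.subgroup_generators_central_chain[of A S, OF A central S(1,2,4) C]) (simp add: A_0)
  then obtain S' where S': "S' \<subseteq> ?C" "finite S'" "card S' \<le> (\<Sum>k<t. card (S k))"
    "?C \<subseteq> generate F (S' \<union> (A t \<inter> ?C))" by blast
  have "A t \<inter> ?C = A t" using A_C by blast
  hence "min_gens (quot F ?C (A t)) \<le> card S'"
    using S'(4) by (intro F.min_gens_quot_le[OF A C A_C S'(1,2)]) simp
  hence "min_gens (quot F ?C (A t)) \<le> (\<Sum>k<t. min_gens (Q k))" using S'(3) unfolding S(3) by simp
  hence 3: "min_gens (quot F ?C (A t)) \<le> min_gens (Q 0) + (\<Sum>k=1..t-1. min_gens (Q k))"
    unfolding split by simp
  show ?thesis unfolding Q_eq mult_R mult_Q using 1 2 3 by blast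
qed

end
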